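(* Let $k\ge 3$ and let $G$ be a mixed $k$-melon graph whose set of paths $\mathcal{P}=\mathcal{P}_{even}\cup\mathcal{P}_{odd}$ satisfies $|\mathcal{P}_{even}|=1$, say $\mathcal{P}_{even}=\{P_e\}$ with vertices $u_0=t,u_1,\dots,u_{2m}=s$ ($m\ge1$). For each odd path $P_o\in\mathcal{P}_{odd}$ write its vertices as $v_0=t,v_1,\dots,v_{2m_o+1}=s$. Define: (i) $U_s$ as the union of $\{s\}\cup\{u_{2j+1}:0\le j\le m-1\}$ and, for every $P_o\in\mathcal{P}_{odd}$, the set $\{v_{2i+1}:0\le i\le m_o\}$ (so $t\notin U_s$); (ii) $U_t$ as the union of $\{t\}\cup\{u_{2j+1}:0\le j\le m-1\}$ and, for every $P_o\in\mathcal{P}_{odd}$, the set $\{v_{2i}:0\le i\le m_o\}$ (so $s\notin U_t$); (iii) for $\mathcal{S}_o\subseteq\mathcal{P}_{odd}$, $U_{\mathcal{S}_o}$ as the vertex set such that $P_e$ is internal, every path of $\mathcal{S}_o$ is an $s$-path and every path of $\mathcal{P}_{odd}\setminus\mathcal{S}_o$ is a $t$-path, all with respect to $U_{\mathcal{S}_o}$. Then $\mathrm{evc}(G)=\mathrm{vc}(G)$, and $\mathcal{U}=\{U_s,U_t\}\cup\{U_{\mathcal{S}_o} : \emptyset\ne\mathcal{S}_o\subsetneq\mathcal{P}_{odd}\}$ is a minimum eternal vertex cover class of $G$.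
   Context: For $k\ge1$, a $k$-melon graph is the union of a set $\mathcal{P}$ of $k$ pairwise internally vertex-disjoint paths, each of length at least $1$, with the same two distinct endpoints $s$ and $t$. $\mathcal{P}_{even}$ and $\mathcal{P}_{odd}$ are the paths of even and odd length; $G$ is mixed if both are nonempty. For an even path $P$ with vertices $v_0,\dots,v_{2m}$, $\{v_0,v_{2m}\}=\{s,t\}$, and a vertex set $U$: $P$ is internal w.r.t. $U$ if $U\cap V(P)=\{v_{2j}:0\le j\le m\}$. For an odd path $P_o$ with vertices $v_0=t,\dots,v_{2m+1}=s$: $P_o$ is an $s$-path w.r.t. $U$ if $(U\cap V(P_o))\setminus\{t\}=\{v_{2i+1}:0\le i\le m\}$, a $t$-path if $(U\cap V(P_o))\setminus\{s\}=\{v_{2i}:0\le i\le m\}$. $\mathrm{vc}(G)$ is the vertex cover number. For a vertex cover $U$ of $G=(V,E)$ and an edge $e=vw$, a defense of $U$ against $e$ is a one-to-one map $\phi:U\to V$ with $\phi(u)\in N[u]$ (closed neighborhood) for all $u\in U$ and $\phi(v)=w$ (with $v\in U$) or $\phi(w)=v$ (with $w\in U$). An eternal vertex cover class is a family $\mathcal{U}$ of vertex covers of equal cardinality (its size) such that for every $U\in\mathcal{U}$ and every edge $e$ there is a defense $\phi$ of $U$ against $e$ with $\phi(U)\in\mathcal{U}$; $\mathrm{evc}(G)$ is the minimum size of such a class, and a class of that size is minimum. *)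

theory Defs
  imports Main
begin

(* An undirected graph is a pair of a vertex set and a set of edges {v, w}. *)

type_synonym 'a ugraph = "'a set \<times> 'a set set"

abbreviation verts :: "'a ugraph \<Rightarrow> 'a set" where "verts \<equiv> fst"

abbreviation edges :: "'a ugraph \<Rightarrow> 'a set set" where "edges \<equiv> snd"

definition finite_simple_graph :: "'a ugraph \<Rightarrow> bool" where
  "finite_simple_graph G \<longleftrightarrow>
     finite (verts G) \<and>
     (\<forall>e \<in> edges G. \<exists>v w. v \<in> verts G \<and> w \<in> verts G \<and> v \<noteq> w \<and> e = {v, w})"

definition closed_nbhd :: "'a ugraph \<Rightarrow> 'a \<Rightarrow> 'a set" where
  "closed_nbhd G u = insert u {w. {u, w} \<in> edges G}"

definition vertex_cover :: "'a ugraph \<Rightarrow> 'a set \<Rightarrow> bool" where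
  "vertex_cover G U \<longleftrightarrow> U \<subseteq> verts G \<and> (\<forall>e \<in> edges G. e \<inter> U \<noteq> {})"

definition vc :: "'a ugraph \<Rightarrow> nat" where
  "vc G = (LEAST n. \<exists>U. vertex_cover G U \<and> card U = n)"

(* phi is only relevant on U. *)

definition defense :: "'a ugraph \<Rightarrow> 'a set \<Rightarrow> 'a \<Rightarrow> 'a \<Rightarrow> ('a \<Rightarrow> 'a) \<Rightarrow> bool" where
  "defense G U v w \<phi> \<longleftrightarrow>
     inj_on \<phi> U \<and>
     (\<forall>u \<in> U. \<phi> u \<in> closed_nbhd G u) \<and>
     ((v \<in> U \<and> \<phi> v = w) \<or> (w \<in> U \<and> \<phi> w = v))"

(* Classes are nonempty: the empty family would satisfy the remaining clauses for every n. *)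

definition evc_class :: "'a ugraph \<Rightarrow> nat \<Rightarrow> 'a set set \<Rightarrow> bool" where
  "evc_class G n \<U> \<longleftrightarrow>
     \<U> \<noteq> {} \<and>
     (\<forall>U \<in> \<U>. vertex_cover G U \<and> card U = n) \<and>
     (\<forall>U \<in> \<U>. \<forall>v w. {v, w} \<in> edges G \<longrightarrow> (\<exists>\<phi>. defense G U v w \<phi> \<and> \<phi> ` U \<in> \<U>))"

definition evc :: "'a ugraph \<Rightarrow> nat" where
  "evc G = (LEAST n. \<exists>\<U>. evc_class G n \<U>)"

definition minimum_evc_class :: "'a ugraph \<Rightarrow> 'a set set \<Rightarrow> bool" where
  "minimum_evc_class G \<U> \<longleftrightarrow> evc_class G (evc G) \<U>"

(* A path is given by the list v_0, ..., v_l of its vertices; its length l counts edges. *)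

definition path_edges :: "'a list \<Rightarrow> 'a set set" where
  "path_edges p = {{p ! i, p ! Suc i} | i. Suc i < length p}"

definition path_length :: "'a list \<Rightarrow> nat" where
  "path_length p = length p - 1"

definition is_path :: "'a \<Rightarrow> 'a \<Rightarrow> 'a list \<Rightarrow> bool" where
  "is_path x y p \<longleftrightarrow> p \<noteq> [] \<and> distinct p \<and> hd p = x \<and> last p = y"

(* All paths of a melon graph are listed from t to s; as s and t differ, each
   path between them has exactly one such list. *)

definition melon_graph :: "nat \<Rightarrow> 'a ugraph \<Rightarrow> 'a \<Rightarrow> 'a \<Rightarrow> 'a list set \<Rightarrow> bool" where
  "melon_graph k G s t \<P> \<longleftrightarrow>
     k \<ge> 1 \<and> s \<noteq> t \<and> finite \<P> \<and> card \<P> = k \<and>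
     (\<forall>p \<in> \<P>. is_path t s p \<and> path_length p \<ge> 1) \<and>
     (\<forall>p \<in> \<P>. \<forall>q \<in> \<P>. p \<noteq> q \<longrightarrow> (set p - {s, t}) \<inter> (set q - {s, t}) = {}) \<and>
     verts G = (\<Union>p \<in> \<P>. set p) \<and>
     edges G = (\<Union>p \<in> \<P>. path_edges p)"

definition even_paths :: "'a list set \<Rightarrow> 'a list set" where
  "even_paths \<P> = {p \<in> \<P>. even (path_length p)}"

definition odd_paths :: "'a list set \<Rightarrow> 'a list set" where
  "odd_paths \<P> = {p \<in> \<P>. odd (path_length p)}"

definition mixed :: "'a list set \<Rightarrow> bool" where
  "mixed \<P> \<longleftrightarrow> even_paths \<P> \<noteq> {} \<and> odd_paths \<P> \<noteq> {}"

(* The number m of a path of length 2m or 2m + 1. *)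

definition half :: "'a list \<Rightarrow> nat" where
  "half p = path_length p div 2"

definition internal_path :: "'a set \<Rightarrow> 'a list \<Rightarrow> bool" where
  "internal_path U p \<longleftrightarrow> U \<inter> set p = {p ! (2 * j) | j. j \<le> half p}"

definition s_path :: "'a \<Rightarrow> 'a set \<Rightarrow> 'a list \<Rightarrow> bool" where
  "s_path t U p \<longleftrightarrow> (U \<inter> set p) - {t} = {p ! (2 * i + 1) | i. i \<le> half p}"

definition t_path :: "'a \<Rightarrow> 'a set \<Rightarrow> 'a list \<Rightarrow> bool" where
  "t_path s U p \<longleftrightarrow> (U \<inter> set p) - {s} = {p ! (2 * i) | i. i \<le> half p}"

definition U_s :: "'a \<Rightarrow> 'a list \<Rightarrow> 'a list set \<Rightarrow> 'a set" where
  "U_s s P\<^sub>e \<P> =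
     {s} \<union> {P\<^sub>e ! (2 * j + 1) | j. j < half P\<^sub>e} \<union>
     (\<Union>p \<in> odd_paths \<P>. {p ! (2 * i + 1) | i. i \<le> half p})"

definition U_t :: "'a \<Rightarrow> 'a list \<Rightarrow> 'a list set \<Rightarrow> 'a set" where
  "U_t t P\<^sub>e \<P> =
     {t} \<union> {P\<^sub>e ! (2 * j + 1) | j. j < half P\<^sub>e} \<union>
     (\<Union>p \<in> odd_paths \<P>. {p ! (2 * i) | i. i \<le> half p})"

definition is_U_odd ::
  "'a ugraph \<Rightarrow> 'a \<Rightarrow> 'a \<Rightarrow> 'a list \<Rightarrow> 'a list set \<Rightarrow> 'a list set \<Rightarrow> 'a set \<Rightarrow> bool" where
  "is_U_odd G s t P\<^sub>e \<P> \<S> U \<longleftrightarrow>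
     U \<subseteq> verts G \<and> internal_path U P\<^sub>e \<and>
     (\<forall>p \<in> \<S>. s_path t U p) \<and>
     (\<forall>p \<in> odd_paths \<P> - \<S>. t_path s U p)"

definition U_odd ::
  "'a ugraph \<Rightarrow> 'a \<Rightarrow> 'a \<Rightarrow> 'a list \<Rightarrow> 'a list set \<Rightarrow> 'a list set \<Rightarrow> 'a set" where
  "U_odd G s t P\<^sub>e \<P> \<S> = (THE U. is_U_odd G s t P\<^sub>e \<P> \<S> U)"

lemma melon_graph_finite_simple:
  assumes "melon_graph k G s t \<P>"
  shows "finite_simple_graph G"
proof -
  have fin: "finite (verts G)" using assms by (auto simp: melon_graph_def)
  have "\<exists>v w. v \<in> verts G \<and> w \<in> verts G \<and> v \<noteq> w \<and> e = {v, w}" if e: "e \<in> edges G" for e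
  proof -
    obtain p i where p: "p \<in> \<P>" "Suc i < length p" "e = {p ! i, p ! Suc i}"
      using e assms by (auto simp: melon_graph_def path_edges_def)
    have "distinct p" using p assms by (auto simp: melon_graph_def is_path_def)
    then have "p ! i \<noteq> p ! Suc i" using p by (simp add: nth_eq_iff_index_eq)
    moreover have "p ! i \<in> verts G" "p ! Suc i \<in> verts G"
      using p assms by (auto simp: melon_graph_def intro!: bexI[of _ p])
    ultimately show ?thesis using p(3) by blast
  qed
  with fin show ?thesis by (simp add: finite_simple_graph_def)
qed

lemma U_odd_unique_existence:
  assumes mel: "melon_graph k G s t \<P>" and ev: "even_paths \<P> = {P\<^sub>e}"
    and S: "\<S> \<subseteq> odd_paths \<P>"
  shows "\<exists>!U. is_U_odd G s t P\<^sub>e \<P> \<S> U"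
proof -
  define ev_set where "ev_set p = {p ! (2 * j) | j. j \<le> half p}" for p :: "'a list"
  define od_set where "od_set p = {p ! (2 * j + 1) | j. j \<le> half p}" for p :: "'a list"
  define A where "A p = (if p \<in> \<S> then od_set p else ev_set p)" for p
  define W where "W = (\<Union>p \<in> \<P>. A p)"
  have st: "s \<noteq> t" using mel by (simp add: melon_graph_def)
  have V: "verts G = (\<Union>p \<in> \<P>. set p)" using mel by (simp add: melon_graph_def)
  have P: "\<P> = insert P\<^sub>e (odd_paths \<P>)" using ev by (auto simp: even_paths_def odd_paths_def)
  have PeP: "P\<^sub>e \<in> \<P>" "even (path_length P\<^sub>e)" "P\<^sub>e \<notin> \<S>"
    using ev S by (auto simp: even_paths_def odd_paths_def)
  have ends: "p ! 0 = t" "p ! path_length p = s" "distinct p" "path_length p < length p"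
    if "p \<in> \<P>" for p
    using that mel
    by (auto simp: melon_graph_def is_path_def path_length_def hd_conv_nth last_conv_nth)
  have disj: "x = s \<or> x = t" if "p \<in> \<P>" "q \<in> \<P>" "p \<noteq> q" "x \<in> set p" "x \<in> set q" for p q x
    using that mel by (auto simp: melon_graph_def)
  have oddp: "p \<in> \<P>" "path_length p = 2 * half p + 1" if "p \<in> odd_paths \<P>" for p
    using that by (auto simp: odd_paths_def half_def)
  have evl: "path_length P\<^sub>e = 2 * half P\<^sub>e" using PeP by (auto simp: half_def)
  have od: "od_set p \<subseteq> set p" "s \<in> od_set p" "t \<notin> od_set p" if p: "p \<in> odd_paths \<P>" for p
  proof -
    note e = ends[OF oddp(1)[OF p]] and l = oddp(2)[OF p]
    show "od_set p \<subseteq> set p" using e l by (auto simp: od_set_def)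
    show "s \<in> od_set p" unfolding od_set_def using e l by force
    have "p ! (2 * i + 1) \<noteq> p ! 0" if "i \<le> half p" for i
      using e l that by (subst nth_eq_iff_index_eq) auto
    then show "t \<notin> od_set p" unfolding od_set_def e(1) by blast
  qed
  have evn: "ev_set p \<subseteq> set p" "t \<in> ev_set p" "s \<notin> ev_set p" if p: "p \<in> odd_paths \<P>" for p
  proof -
    note e = ends[OF oddp(1)[OF p]] and l = oddp(2)[OF p]
    show "ev_set p \<subseteq> set p" using e l by (auto simp: ev_set_def)
    show "t \<in> ev_set p" unfolding ev_set_def using e l by force
    have "p ! (2 * i) \<noteq> p ! path_length p" if "i \<le> half p" for i
      using e l that by (subst nth_eq_iff_index_eq) auto
    then show "s \<notin> ev_set p" unfolding ev_set_def e(2) by blast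
  qed
  have Pe: "ev_set P\<^sub>e \<subseteq> set P\<^sub>e" "t \<in> ev_set P\<^sub>e" "s \<in> ev_set P\<^sub>e"
  proof -
    note e = ends[OF PeP(1)]
    show "ev_set P\<^sub>e \<subseteq> set P\<^sub>e" using e evl by (auto simp: ev_set_def)
    show "t \<in> ev_set P\<^sub>e" unfolding ev_set_def using e by force
    show "s \<in> ev_set P\<^sub>e" unfolding ev_set_def using e evl by force
  qed
  have Asub: "A p \<subseteq> set p" if "p \<in> \<P>" for p
  proof (cases "p = P\<^sub>e")
    case True
    then show ?thesis using Pe PeP by (simp add: A_def)
  next
    case False
    then have "p \<in> odd_paths \<P>" using that P by blast
    then show ?thesis using od evn by (simp add: A_def)
  qed
  have APe: "A P\<^sub>e = ev_set P\<^sub>e" using PeP by (simp add: A_def)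
  have W1: "A p \<subseteq> W \<inter> set p" "W \<inter> set p \<subseteq> A p \<union> {s, t}" if "p \<in> \<P>" for p
    using that Asub disj unfolding W_def by blast+
  have exi: "is_U_odd G s t P\<^sub>e \<P> \<S> W"
    unfolding is_U_odd_def
  proof (intro conjI ballI)
    show "W \<subseteq> verts G" using Asub by (auto simp: W_def V)
    show "internal_path W P\<^sub>e"
      unfolding internal_path_def ev_set_def[symmetric] using W1[OF PeP(1)] APe Pe by auto
    fix p
    show "s_path t W p" if p: "p \<in> \<S>"
    proof -
      have po: "p \<in> odd_paths \<P>" and "A p = od_set p" using p S by (auto simp: A_def)
      then show ?thesis
        unfolding s_path_def od_set_def[symmetric] using W1[OF oddp(1)[OF po]] od[OF po] by auto
    qed
    show "t_path s W p" if p: "p \<in> odd_paths \<P> - \<S>"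
    proof -
      have po: "p \<in> odd_paths \<P>" and "A p = ev_set p" using p by (auto simp: A_def)
      then show ?thesis
        unfolding t_path_def ev_set_def[symmetric] using W1[OF oddp(1)[OF po]] evn[OF po] by auto
    qed
  qed
  have "U = W" if U: "is_U_odd G s t P\<^sub>e \<P> \<S> U" for U
  proof -
    have key: "U1 \<inter> set p \<subseteq> U2" if U12: "is_U_odd G s t P\<^sub>e \<P> \<S> U1" "is_U_odd G s t P\<^sub>e \<P> \<S> U2"
      and p: "p \<in> \<P>" for U1 U2 p
    proof -
      have i: "U1 \<inter> set P\<^sub>e = U2 \<inter> set P\<^sub>e" "s \<in> U2" "t \<in> U2"
        using U12 Pe unfolding is_U_odd_def internal_path_def ev_set_def[symmetric] by blast+
      consider "p = P\<^sub>e" | "p \<in> \<S>" | "p \<in> odd_paths \<P> - \<S>" using p P by blast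
      then show ?thesis
      proof cases
        case 1
        then show ?thesis using i by blast
      next
        case 2
        then have "(U1 \<inter> set p) - {t} = (U2 \<inter> set p) - {t}"
          using U12 by (simp add: is_U_odd_def s_path_def)
        then show ?thesis using i by blast
      next
        case 3
        then have "(U1 \<inter> set p) - {s} = (U2 \<inter> set p) - {s}"
          using U12 by (simp add: is_U_odd_def t_path_def)
        then show ?thesis using i by blast
      qed
    qed
    have "U \<subseteq> verts G" "W \<subseteq> verts G" using U exi by (auto simp: is_U_odd_def)
    then show ?thesis using key[OF U exi] key[OF exi U] unfolding V by blast
  qed
  with exi show ?thesis by blast
qed

end

theory Submission
  imports Defs
begin

text \<open>
  On each path a member of the class guards either the inner vertices at odd positions or those at
  even positions, counted from \<open>t\<close>.  To go from \<open>U\<^sub>s\<close> to \<open>U\<^sub>\<S>\<close>, the paths outside \<open>\<S>\<close> have to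
  change parity.  The guards of one of them, a freely chosen path \<open>d\<close>, step towards \<open>t\<close>, those of
  all others towards \<open>s\<close>.  If \<open>d\<close> has odd length, the guard of \<open>s\<close> enters \<open>d\<close> and is replaced by one
  from the even path; otherwise it stays.  Each edge of a path outside \<open>\<S>\<close> is crossed either when
  \<open>d\<close> is that path or when \<open>d\<close> is another one.

  Guard moves can be undone, and listing the paths from \<open>s\<close> to \<open>t\<close> exchanges \<open>U\<^sub>s\<close> and \<open>U\<^sub>t\<close>.  So
  the moves between \<open>U\<^sub>s\<close> and \<open>U\<^sub>\<S>\<close> answer every attack on a path outside \<open>\<S>\<close>, those between \<open>U\<^sub>t\<close>
  and \<open>U\<^sub>\<S>\<close> every attack on the even path or a path in \<open>\<S>\<close>; moves between two sets \<open>U\<^sub>\<S>\<close> are not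
  needed.

  For the lower bound, a vertex cover containing \<open>s\<close> has more elements than any matching of
  \<open>G - s\<close>.  If \<open>s\<close> is not in the cover, edges that meet only in \<open>s\<close> are covered by different
  vertices as well.
\<close>

section \<open>Guard moves\<close>

definition transition :: "'a ugraph \<Rightarrow> 'a \<Rightarrow> 'a \<Rightarrow> 'a set \<Rightarrow> 'a set \<Rightarrow> bool" where
  "transition G v w U W \<longleftrightarrow> (\<exists>\<phi>. defense G U v w \<phi> \<and> \<phi> ` U = W)"

lemma transition_commute: "transition G v w U W \<longleftrightarrow> transition G w v U W"
  by (auto simp: transition_def defense_def)

lemma closed_nbhd_sym: "w \<in> closed_nbhd G u \<longleftrightarrow> u \<in> closed_nbhd G w"
  by (auto simp: closed_nbhd_def insert_commute)

lemma transition_sym: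
  assumes "transition G v w U W"
  shows "transition G v w W U"
proof -
  obtain \<phi> where \<phi>: "defense G U v w \<phi>" and W: "W = \<phi> ` U"
    using assms by (auto simp: transition_def)
  have inj: "inj_on \<phi> U"
    using \<phi> by (simp add: defense_def)
  have "defense G W v w (inv_into U \<phi>)"
    using \<phi> inj closed_nbhd_sym[of _ G] unfolding W
    by (auto simp: defense_def inj_on_inv_into)
  moreover have "inv_into U \<phi> ` W = U"
    using inj by (simp add: W inv_into_image_cancel)
  ultimately show ?thesis
    by (auto simp: transition_def)
qed

lemma transition_onto:
  assumes "finite U" "card W = card U" "W \<subseteq> \<phi> ` U"
    and "\<And>u. u \<in> U \<Longrightarrow> \<phi> u \<in> closed_nbhd G u" "v \<in> U" "\<phi> v = w"
  shows "transition G v w U W"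
proof -
  have "card (\<phi> ` U) \<le> card W"
    using assms by (simp add: card_image_le)
  then have onto: "\<phi> ` U = W"
    using assms by (metis card_seteq finite_imageI)
  then have "inj_on \<phi> U"
    using assms by (intro eq_card_imp_inj_on) auto
  then show ?thesis
    using assms onto by (auto simp: transition_def defense_def)
qed

lemma evc_classI:
  assumes "\<U> \<noteq> {}" "\<And>U. U \<in> \<U> \<Longrightarrow> vertex_cover G U" "\<And>U. U \<in> \<U> \<Longrightarrow> card U = n"
    and "\<And>U v w. U \<in> \<U> \<Longrightarrow> {v, w} \<in> edges G \<Longrightarrow> \<exists>W \<in> \<U>. transition G v w U W"
  shows "evc_class G n \<U>"
  using assms unfolding evc_class_def transition_def by blast

lemma vc_eqI:
  assumes "vertex_cover G U" "\<And>W. vertex_cover G W \<Longrightarrow> card U \<le> card W"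
  shows "vc G = card U"
  unfolding vc_def using assms by (intro Least_equality) auto

lemma vc_le_card: "vertex_cover G U \<Longrightarrow> vc G \<le> card U"
  unfolding vc_def by (rule Least_le) blast

lemma evc_eq_vc_if_evc_class:
  assumes "evc_class G (vc G) \<U>"
  shows "evc G = vc G"
  unfolding evc_def
proof (rule Least_equality)
  show "vc G \<le> n" if "\<exists>\<U>. evc_class G n \<U>" for n
  proof -
    from that obtain U where "vertex_cover G U" "card U = n"
      unfolding evc_class_def by blast
    then show ?thesis
      using vc_le_card by blast
  qed
qed (use assms in blast)

lemma card_le_card_hitting_set:
  assumes "finite U" "\<And>i. i \<in> I \<Longrightarrow> E i \<inter> U \<noteq> {}"
    and "\<And>i j. i \<in> I \<Longrightarrow> j \<in> I \<Longrightarrow> i \<noteq> j \<Longrightarrow> E i \<inter> E j \<inter> U = {}"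
  shows "card I \<le> card U"
proof -
  have "\<forall>i \<in> I. \<exists>x. x \<in> E i \<inter> U"
    using assms(2) by blast
  then obtain f where f: "\<And>i. i \<in> I \<Longrightarrow> f i \<in> E i \<inter> U"
    by metis
  then have "inj_on f I"
    using assms(3) by (fastforce simp: inj_on_def)
  then show ?thesis
    using f assms(1) by (intro card_inj_on_le) auto
qed

section \<open>Alternating vertex sets\<close>

definition inner_parity :: "bool \<Rightarrow> 'a list \<Rightarrow> 'a set" where
  "inner_parity b p = (!) p ` {i. 0 < i \<and> i < path_length p \<and> (odd i \<longleftrightarrow> b)}"

lemma inner_parity_subset: "inner_parity b p \<subseteq> set p"
  by (auto simp: inner_parity_def path_length_def)

lemma card_inner_parity:
  assumes "distinct p"
  shows "card (inner_parity b p) = (if b then half p else (path_length p - 1) div 2)"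
proof -
  have "card (inner_parity b p) = card {i. 0 < i \<and> i < path_length p \<and> (odd i \<longleftrightarrow> b)}"
    unfolding inner_parity_def using assms
    by (intro card_image) (auto simp: inj_on_def nth_eq_iff_index_eq path_length_def)
  moreover have "{i. 0 < i \<and> i < n \<and> odd i} = (\<lambda>j. 2 * j + 1) ` {..<n div 2}" for n :: nat
    by (auto elim!: oddE simp: image_iff)
  moreover have "{i. 0 < i \<and> i < n \<and> even i} = (\<lambda>j. 2 * j + 2) ` {..<(n - 1) div 2}" for n :: nat
    by (auto simp: image_def Bex_def) presburger
  ultimately show ?thesis
    by (simp add: half_def card_image inj_on_def)
qed

lemma odd_positions_odd_path:
  assumes "odd (path_length p)"
  shows "{p ! Suc (2 * i) | i. i \<le> half p} = insert (p ! path_length p) (inner_parity True p)"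
proof -
  have "(\<lambda>i. Suc (2 * i)) ` {..half p} =
      insert (path_length p) {i. 0 < i \<and> i < path_length p \<and> odd i}"
    using assms by (auto elim!: oddE simp: half_def image_iff)
  then have "(!) p ` (\<lambda>i. Suc (2 * i)) ` {..half p} =
      insert (p ! path_length p) (inner_parity True p)"
    by (simp add: inner_parity_def)
  then show ?thesis
    by auto
qed

lemma even_positions_odd_path:
  assumes "odd (path_length p)"
  shows "{p ! (2 * i) | i. i \<le> half p} = insert (p ! 0) (inner_parity False p)"
proof -
  have "(\<lambda>i. 2 * i) ` {..half p} = insert 0 {i. 0 < i \<and> i < path_length p \<and> even i}"
    using assms by (auto elim!: evenE oddE simp: half_def image_iff)
  then have "(!) p ` (\<lambda>i. 2 * i) ` {..half p} = insert (p ! 0) (inner_parity False p)"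
    by (simp add: inner_parity_def)
  then show ?thesis
    by auto
qed

lemma odd_positions_even_path:
  assumes "even (path_length p)"
  shows "{p ! Suc (2 * i) | i. i < half p} = inner_parity True p"
proof -
  have "(\<lambda>i. Suc (2 * i)) ` {..<half p} = {i. 0 < i \<and> i < path_length p \<and> odd i}"
    using assms by (auto elim!: oddE simp: half_def image_iff)
  then have "(!) p ` (\<lambda>i. Suc (2 * i)) ` {..<half p} = inner_parity True p"
    by (simp add: inner_parity_def)
  then show ?thesis
    by auto
qed

lemma even_positions_even_path:
  assumes "even (path_length p)"
  shows "{p ! (2 * i) | i. i \<le> half p} =
    insert (p ! 0) (insert (p ! path_length p) (inner_parity False p))"
proof -
  have "(\<lambda>i. 2 * i) ` {..half p} =
      insert 0 (insert (path_length p) {i. 0 < i \<and> i < path_length p \<and> even i})"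
    using assms by (auto elim!: evenE simp: half_def image_iff)
  then have "(!) p ` (\<lambda>i. 2 * i) ` {..half p} =
      insert (p ! 0) (insert (p ! path_length p) (inner_parity False p))"
    by (simp add: inner_parity_def)
  then show ?thesis
    by auto
qed

definition alternating_set :: "'a list set \<Rightarrow> 'a set \<Rightarrow> 'a list set \<Rightarrow> 'a set" where
  "alternating_set \<P> X M = X \<union> (\<Union>p \<in> \<P>. inner_parity (p \<in> M) p)"

section \<open>Reversing the paths\<close>

lemma path_length_rev: "path_length (rev p) = path_length p"
  by (simp add: path_length_def)

lemma rev_nth_path_length: "i < length p \<Longrightarrow> rev p ! i = p ! (path_length p - i)"
  by (simp add: rev_nth path_length_def)

lemma inner_parity_rev: "inner_parity b (rev p) = inner_parity (b \<longleftrightarrow> even (path_length p)) p"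
proof -
  have "inner_parity b (rev p) \<subseteq> inner_parity (b \<longleftrightarrow> even (path_length p)) p" for p :: "'a list" and b
  proof
    fix x assume "x \<in> inner_parity b (rev p)"
    then obtain i where i: "0 < i" "i < path_length p" "odd i \<longleftrightarrow> b" "x = rev p ! i"
      by (auto simp: inner_parity_def path_length_rev)
    then have "x = p ! (path_length p - i)"
      by (simp add: rev_nth_path_length path_length_def)
    then show "x \<in> inner_parity (b \<longleftrightarrow> even (path_length p)) p"
      using i by (auto simp: inner_parity_def)
  qed
  from this[of b p] this[of "b \<longleftrightarrow> even (path_length p)" "rev p"] show ?thesis
    by (cases b; cases "even (path_length p)") (simp_all add: path_length_rev)
qed

lemma alternating_set_rev:
  "alternating_set (rev ` \<P>) X (rev ` M) =
    alternating_set \<P> X {p \<in> \<P>. p \<in> M \<longleftrightarrow> even (path_length p)}"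
  by (auto simp: alternating_set_def inner_parity_rev inj_image_mem_iff)

lemma path_edges_rev: "path_edges (rev p) = path_edges p"
proof -
  have "path_edges (rev p) \<subseteq> path_edges p" for p :: "'a list"
  proof
    fix e assume "e \<in> path_edges (rev p)"
    then obtain i where "Suc i < length p" "e = {rev p ! i, rev p ! Suc i}"
      by (auto simp: path_edges_def)
    then have "Suc (length p - Suc (Suc i)) < length p"
      "e = {p ! (length p - Suc (Suc i)), p ! Suc (length p - Suc (Suc i))}"
      by (auto simp: rev_nth Suc_diff_Suc)
    then show "e \<in> path_edges p"
      unfolding path_edges_def by blast
  qed
  from this[of p] this[of "rev p"] show ?thesis
    by auto
qed

lemma melon_graph_rev:
  assumes "melon_graph k G s t \<P>"
  shows "melon_graph k G t s (rev ` \<P>)"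
  using assms unfolding melon_graph_def is_path_def
  by (auto simp: card_image path_length_rev path_edges_rev hd_rev last_rev insert_commute)

lemma even_paths_rev: "even_paths (rev ` \<P>) = rev ` even_paths \<P>"
  by (auto simp: even_paths_def path_length_rev)

lemma odd_paths_rev: "odd_paths (rev ` \<P>) = rev ` odd_paths \<P>"
  by (auto simp: odd_paths_def path_length_rev)

section \<open>Melon graphs\<close>

locale melon =
  fixes k :: nat and G :: "'a ugraph" and s t :: 'a and \<P> :: "'a list set"
  assumes melon: "melon_graph k G s t \<P>"
begin

abbreviation len :: "'a list \<Rightarrow> nat" where "len \<equiv> path_length"

lemma s_neq_t: "s \<noteq> t"
  using melon by (simp add: melon_graph_def)

lemma finite_paths: "finite \<P>"
  using melon by (simp add: melon_graph_def)

lemma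
  assumes "p \<in> \<P>"
  shows path_nth_0: "p ! 0 = t"
    and path_nth_len: "p ! len p = s"
    and path_distinct: "distinct p"
    and length_path: "length p = Suc (len p)"
    and len_pos: "0 < len p"
  using assms melon
  by (auto simp: melon_graph_def is_path_def path_length_def hd_conv_nth last_conv_nth)

lemma path_nth_eq_iff:
  assumes "p \<in> \<P>" "i \<le> len p" "j \<le> len p"
  shows "p ! i = p ! j \<longleftrightarrow> i = j"
  using assms path_distinct length_path by (simp add: nth_eq_iff_index_eq)

lemma ends_in_path:
  assumes "p \<in> \<P>"
  shows "s \<in> set p" "t \<in> set p"
  using nth_mem[of "len p" p] nth_mem[of 0 p] path_nth_len[OF assms] path_nth_0[OF assms]
    length_path[OF assms] by simp_all

lemma inner_nth_neq_ends:
  assumes "p \<in> \<P>" "0 < i" "i < len p"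
  shows "p ! i \<noteq> s" "p ! i \<noteq> t"
  using path_nth_eq_iff[OF assms(1), of i "len p"] path_nth_eq_iff[OF assms(1), of i 0]
    path_nth_len[OF assms(1)] path_nth_0[OF assms(1)] assms by auto

lemma nth_eq_nthD:
  assumes "p \<in> \<P>" "q \<in> \<P>" "i \<le> len p" "j \<le> len q" "p ! i = q ! j" "p ! i \<noteq> s"
  shows "p = q \<and> i = j \<or> i = 0 \<and> j = 0"
proof (cases "p = q")
  case True
  then show ?thesis
    using assms path_nth_eq_iff by blast
next
  case False
  have "p ! i \<in> set p" "q ! j \<in> set q"
    using assms length_path[of p] length_path[of q] nth_mem[of i p] nth_mem[of j q] by simp_all
  then have "p ! i = t"
    using False assms melon by (fastforce simp: melon_graph_def)
  then show ?thesis
    using assms path_nth_0 path_nth_eq_iff by (metis le0)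
qed

lemma inner_nth_eq_iff:
  assumes "p \<in> \<P>" "0 < i" "i < len p" "q \<in> \<P>" "0 < j" "j < len q"
  shows "p ! i = q ! j \<longleftrightarrow> p = q \<and> i = j"
proof
  assume "p ! i = q ! j"
  then show "p = q \<and> i = j"
    using nth_eq_nthD[of p q i j] inner_nth_neq_ends(1)[OF assms(1-3)] assms
    by (metis less_imp_le less_irrefl)
qed simp

lemma verts_eq: "verts G = (\<Union>p \<in> \<P>. set p)"
  using melon by (simp add: melon_graph_def)

lemma finite_verts: "finite (verts G)"
  using finite_paths by (simp add: verts_eq)

lemma edges_eq: "edges G = (\<Union>p \<in> \<P>. (\<lambda>i. {p ! i, p ! Suc i}) ` {..<len p})"
proof -
  have "path_edges p = (\<lambda>i. {p ! i, p ! Suc i}) ` {..<len p}" if "p \<in> \<P>" for p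
    using length_path[OF that] by (auto simp: path_edges_def)
  then show ?thesis
    using melon by (simp add: melon_graph_def)
qed

lemma edgeE:
  assumes "{v, w} \<in> edges G"
  obtains (up) p i where "p \<in> \<P>" "i < len p" "v = p ! i" "w = p ! Suc i"
  | (down) p i where "p \<in> \<P>" "i < len p" "v = p ! Suc i" "w = p ! i"
proof -
  obtain p i where "p \<in> \<P>" "i < len p" "{v, w} = {p ! i, p ! Suc i}"
    using assms by (auto simp: edges_eq)
  then show ?thesis
    using that by (metis doubleton_eq_iff)
qed

lemma vertex_cover_iff:
  "vertex_cover G U \<longleftrightarrow>
    U \<subseteq> verts G \<and> (\<forall>p \<in> \<P>. \<forall>i < len p. p ! i \<in> U \<or> p ! Suc i \<in> U)"
proof -
  have "{v, w} \<inter> U \<noteq> {} \<longleftrightarrow> v \<in> U \<or> w \<in> U" for v w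
    by blast
  then show ?thesis
    by (simp add: vertex_cover_def edges_eq lessThan_def)
qed

lemma nth_Suc_in_nbhd:
  assumes "p \<in> \<P>" "i < len p"
  shows "p ! Suc i \<in> closed_nbhd G (p ! i)"
  using assms by (auto simp: closed_nbhd_def edges_eq)

lemma sum_le_card_hitting_set:
  assumes "finite U" "s \<notin> U"
    and index: "\<And>p j. p \<in> \<P> \<Longrightarrow> j < n p \<Longrightarrow> Suc (start p + 2 * j) \<le> len p"
    and hit: "\<And>p j. p \<in> \<P> \<Longrightarrow> j < n p \<Longrightarrow> p ! (start p + 2 * j) \<in> U \<or> p ! Suc (start p + 2 * j) \<in> U"
    and start_unique: "\<And>p q. p \<in> \<P> \<Longrightarrow> q \<in> \<P> \<Longrightarrow> start p = 0 \<Longrightarrow> start q = 0 \<Longrightarrow> p = q"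
  shows "(\<Sum>p \<in> \<P>. n p) \<le> card U"
proof -
  define E where "E = (\<lambda>(p, j). {p ! (start p + 2 * j), p ! Suc (start p + 2 * j)})"
  define I where "I = (SIGMA p : \<P>. {..<n p})"
  have disjoint: "x = y" if "x \<in> I" "y \<in> I" "v \<in> E x" "v \<in> E y" "v \<in> U" for x y v
  proof -
    obtain p i i' where p: "x = (p, i)" "p \<in> \<P>" "i < n p"
      and i': "v = p ! i'" "i' = start p + 2 * i \<or> i' = Suc (start p + 2 * i)"
      using \<open>x \<in> I\<close> \<open>v \<in> E x\<close> by (auto simp: I_def E_def)
    obtain q j j' where q: "y = (q, j)" "q \<in> \<P>" "j < n q"
      and j': "v = q ! j'" "j' = start q + 2 * j \<or> j' = Suc (start q + 2 * j)"
      using \<open>y \<in> I\<close> \<open>v \<in> E y\<close> by (auto simp: I_def E_def)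
    have "i' \<le> len p" "j' \<le> len q" "p ! i' = q ! j'" "p ! i' \<noteq> s"
      using index[OF p(2,3)] index[OF q(2,3)] i' j' \<open>v \<in> U\<close> \<open>s \<notin> U\<close> by auto
    then consider (inner) "p = q" "i' = j'" | (root) "i' = 0" "j' = 0"
      using nth_eq_nthD[OF p(2) q(2)] by blast
    then show "x = y"
    proof cases
      case inner
      then have "i = j"
        using i'(2) j'(2) by presburger
      with inner show ?thesis
        by (simp add: p q)
    next
      case root
      then show ?thesis
        using i'(2) j'(2) start_unique[OF p(2) q(2)] by (simp add: p q)
    qed
  qed
  have "card I \<le> card U"
  proof (rule card_le_card_hitting_set[OF \<open>finite U\<close>])
    show "E x \<inter> U \<noteq> {}" if "x \<in> I" for x
      using that hit by (fastforce simp: I_def E_def)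
    show "E x \<inter> E y \<inter> U = {}" if "x \<in> I" "y \<in> I" "x \<noteq> y" for x y
      using disjoint that by blast
  qed
  then show ?thesis
    using finite_paths by (simp add: I_def)
qed

lemma card_vertex_cover_ge:
  fixes U :: "'a set"
  defines "c \<equiv> of_bool (s \<in> U) :: nat"
  assumes U: "vertex_cover G U" and r: "r \<in> \<P>"
  shows "c + (Suc (len r) - c) div 2 + (\<Sum>p \<in> \<P> - {r}. (len p - c) div 2) \<le> card U"
proof -
  define start where "start p = (if p = r then 0 else 1 :: nat)" for p
  define n where "n p = (Suc (len p) - c - start p) div 2" for p
  have "finite U"
    using U finite_verts finite_subset by (auto simp: vertex_cover_def)
  have index: "Suc (start p + 2 * j) + c \<le> len p" if "j < n p" for p j
    using that by (auto simp: n_def)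
  have "(\<Sum>p \<in> \<P>. n p) \<le> card (U - {s})"
  proof (rule sum_le_card_hitting_set[where start = start])
    fix p j assume p: "p \<in> \<P>" and j: "j < n p"
    show "Suc (start p + 2 * j) \<le> len p"
      using index[OF j] by simp
    have "p ! (start p + 2 * j) \<in> U \<or> p ! Suc (start p + 2 * j) \<in> U"
      using U p index[OF j] by (simp add: vertex_cover_iff)
    moreover have "p ! (start p + 2 * j) \<noteq> s \<and> p ! Suc (start p + 2 * j) \<noteq> s" if "s \<in> U"
      using that index[OF j] path_nth_eq_iff[OF p, of _ "len p"] path_nth_len[OF p]
      by (simp add: c_def)
    ultimately show "p ! (start p + 2 * j) \<in> U - {s} \<or> p ! Suc (start p + 2 * j) \<in> U - {s}"
      by auto
  qed (use \<open>finite U\<close> in \<open>auto simp: start_def split: if_splits\<close>)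
  moreover have "(\<Sum>p \<in> \<P>. n p) = n r + (\<Sum>p \<in> \<P> - {r}. n p)"
    by (rule sum.remove[OF finite_paths r])
  moreover have "n r = (Suc (len r) - c) div 2"
    by (simp add: n_def start_def)
  moreover have "(\<Sum>p \<in> \<P> - {r}. n p) = (\<Sum>p \<in> \<P> - {r}. (len p - c) div 2)"
    by (intro sum.cong) (auto simp: n_def start_def)
  moreover have "card U = c + card (U - {s})"
    using \<open>finite U\<close> card_Suc_Diff1[of U s] by (simp add: c_def)
  ultimately show ?thesis
    by simp
qed

lemma nth_in_alternating_set_iff:
  assumes "p \<in> \<P>" "0 < i" "i < len p" "X \<subseteq> {s, t}"
  shows "p ! i \<in> alternating_set \<P> X M \<longleftrightarrow> (odd i \<longleftrightarrow> p \<in> M)"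
proof -
  have "p ! i \<notin> X"
    using assms inner_nth_neq_ends by blast
  moreover have "p ! i \<in> inner_parity (q \<in> M) q \<longleftrightarrow> q = p \<and> (odd i \<longleftrightarrow> p \<in> M)" if "q \<in> \<P>" for q
    using that assms inner_nth_eq_iff[OF assms(1-3)] by (auto simp: inner_parity_def)
  ultimately show ?thesis
    using assms(1) by (auto simp: alternating_set_def)
qed

lemma ends_notin_inner_parity:
  assumes "p \<in> \<P>"
  shows "s \<notin> inner_parity b p" "t \<notin> inner_parity b p"
  using inner_nth_neq_ends[OF assms] by (auto simp: inner_parity_def)

lemma end_in_alternating_set_iff:
  assumes "v \<in> {s, t}"
  shows "v \<in> alternating_set \<P> X M \<longleftrightarrow> v \<in> X"
  using assms ends_notin_inner_parity by (auto simp: alternating_set_def)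

lemma alternating_set_Int_path:
  assumes "p \<in> \<P>"
  shows "alternating_set \<P> {s, t} M \<inter> set p = {s, t} \<union> inner_parity (p \<in> M) p"
proof (intro equalityI subsetI)
  fix v assume v: "v \<in> alternating_set \<P> {s, t} M \<inter> set p"
  then obtain i where "i \<le> len p" "v = p ! i"
    using length_path[OF assms] by (auto simp: in_set_conv_nth less_Suc_eq_le)
  then show "v \<in> {s, t} \<union> inner_parity (p \<in> M) p"
    using v nth_in_alternating_set_iff[OF assms, of i "{s, t}" M]
      path_nth_0[OF assms] path_nth_len[OF assms]
    by (cases "i = 0"; cases "i = len p") (auto simp: inner_parity_def)
next
  fix v assume "v \<in> {s, t} \<union> inner_parity (p \<in> M) p"
  then show "v \<in> alternating_set \<P> {s, t} M \<inter> set p"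
    using ends_in_path[OF assms] inner_parity_subset[of "p \<in> M" p] assms
    by (auto simp: alternating_set_def)
qed

lemma alternating_set_subset_verts:
  assumes "X \<subseteq> {s, t}"
  shows "alternating_set \<P> X M \<subseteq> verts G"
proof -
  obtain p where "p \<in> \<P>"
    using melon by (force simp: melon_graph_def)
  then have "X \<subseteq> verts G"
    using ends_in_path assms by (auto simp: verts_eq)
  then show ?thesis
    using inner_parity_subset by (fastforce simp: alternating_set_def verts_eq)
qed

lemma card_alternating_set:
  assumes X: "X \<subseteq> {s, t}"
  shows "card (alternating_set \<P> X M) =
    card X + (\<Sum>p \<in> \<P>. if p \<in> M then half p else (len p - 1) div 2)"
proof -
  let ?inner = "\<Union>p \<in> \<P>. inner_parity (p \<in> M) p"
  have finite: "finite (inner_parity b p)" for b and p :: "'a list"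
    by (rule finite_subset[OF inner_parity_subset]) simp
  have "inner_parity b p \<inter> inner_parity b' q = {}" if "p \<in> \<P>" "q \<in> \<P>" "p \<noteq> q" for b b' p q
    using that by (auto simp: inner_parity_def inner_nth_eq_iff)
  then have "card ?inner = (\<Sum>p \<in> \<P>. card (inner_parity (p \<in> M) p))"
    using finite_paths finite by (intro card_UN_disjoint) auto
  also have "\<dots> = (\<Sum>p \<in> \<P>. if p \<in> M then half p else (len p - 1) div 2)"
    using path_distinct by (intro sum.cong refl) (simp add: card_inner_parity)
  finally have "card ?inner = \<dots>" .
  moreover have "X \<inter> ?inner = {}"
    using X ends_notin_inner_parity by blast
  moreover have "finite X" "finite ?inner"
    using finite_subset[OF X] finite_paths finite by simp_all
  ultimately show ?thesis
    unfolding alternating_set_def by (simp add: card_Un_disjoint)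
qed

lemma vertex_cover_alternating_set:
  assumes X: "X \<subseteq> {s, t}" "s \<in> X" and M: "t \<in> X \<or> \<P> \<subseteq> M"
  shows "vertex_cover G (alternating_set \<P> X M)"
  unfolding vertex_cover_iff
proof (intro conjI ballI allI impI alternating_set_subset_verts X)
  fix p i assume p: "p \<in> \<P>" and "i < len p"
  note member = nth_in_alternating_set_iff[OF p _ _ X(1), of _ M] end_in_alternating_set_iff
  consider "Suc i = len p" | "i = 0" "t \<in> X" | "i = 0" "p \<in> M" "Suc i < len p"
    | "0 < i" "Suc i < len p"
    using M p \<open>i < len p\<close> by fastforce
  then show "p ! i \<in> alternating_set \<P> X M \<or> p ! Suc i \<in> alternating_set \<P> X M"
    using X(2) path_nth_0[OF p] path_nth_len[OF p]
    by cases (auto simp: member)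
qed

lemma odd_nth_in_alternating_set:
  assumes "p \<in> \<P>" "odd i" "i \<le> len p"
  shows "p ! i \<in> alternating_set \<P> {s} \<P>"
  using assms path_nth_len end_in_alternating_set_iff[of s]
    nth_in_alternating_set_iff[of p i "{s}" \<P>]
  by (cases "i = len p") (auto intro: odd_pos)

definition position :: "'a \<Rightarrow> 'a list \<times> nat" where
  "position = inv_into (SIGMA p : \<P>. {0<..<len p}) (\<lambda>(p, i). p ! i)"

lemma position_nth:
  assumes "p \<in> \<P>" "0 < i" "i < len p"
  shows "position (p ! i) = (p, i)"
proof -
  have "inj_on (\<lambda>(p, i). p ! i) (SIGMA p : \<P>. {0<..<len p})"
    by (auto simp: inj_on_def inner_nth_eq_iff)
  then show ?thesis
    using assms inv_into_f_f[of "\<lambda>(p, i). p ! i" _ "(p, i)"] by (simp add: position_def)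
qed

definition shift :: "'a list set \<Rightarrow> 'a list \<Rightarrow> 'a \<Rightarrow> 'a" where
  "shift \<S> d v =
    (if v = s then if even (len d) then s else d ! (len d - 1)
     else case position v of (p, i) \<Rightarrow> p ! (if p = d then i - 1 else if p \<in> \<S> then i else Suc i))"

lemma shift_inner_nth:
  assumes "p \<in> \<P>" "0 < i" "i < len p"
  shows "shift \<S> d (p ! i) = p ! (if p = d then i - 1 else if p \<in> \<S> then i else Suc i)"
  using assms inner_nth_neq_ends position_nth by (simp add: shift_def)

lemma shift_down:
  assumes "d \<in> \<P>" "even i" "i < len d"
  shows "shift \<S> d (d ! Suc i) = d ! i"
proof (cases "Suc i = len d")
  case True
  then have "odd (len d)" "len d - 1 = i"
    using assms(2) by (auto simp flip: True)
  then show ?thesis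
    using True path_nth_len[OF assms(1)] by (simp add: shift_def)
next
  case False
  then show ?thesis
    using assms by (simp add: shift_inner_nth)
qed

lemma shift_up:
  assumes "p \<in> \<P> - \<S>" "p \<noteq> d" "odd i" "i < len p"
  shows "shift \<S> d (p ! i) = p ! Suc i"
  using assms by (simp add: shift_inner_nth odd_pos)

lemma shift_in_nbhd:
  assumes v: "v \<in> alternating_set \<P> {s} \<P>" and d: "d \<in> \<P>"
  shows "shift \<S> d v \<in> closed_nbhd G v"
proof -
  consider (s) "v = s" | (inner) p i where "p \<in> \<P>" "0 < i" "i < len p" "v = p ! i"
    using v by (auto simp: alternating_set_def inner_parity_def)
  then show ?thesis
  proof cases
    case s
    have "d ! (len d - 1) \<in> closed_nbhd G s"
      using nth_Suc_in_nbhd[OF d, of "len d - 1"] closed_nbhd_sym len_pos[OF d] path_nth_len[OF d]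
      by fastforce
    then show ?thesis
      using s by (simp add: shift_def closed_nbhd_def)
  next
    case (inner p i)
    have "p ! (i - 1) \<in> closed_nbhd G (p ! i)" "p ! Suc i \<in> closed_nbhd G (p ! i)"
      using inner nth_Suc_in_nbhd[of p "i - 1"] nth_Suc_in_nbhd[of p i] closed_nbhd_sym
      by fastforce+
    then show ?thesis
      using inner by (auto simp: shift_inner_nth closed_nbhd_def)
  qed
qed

lemma shift_image_down:
  assumes "d \<in> \<P>" "even i" "i < len d"
  shows "d ! i \<in> shift \<S> d ` alternating_set \<P> {s} \<P>"
  using assms odd_nth_in_alternating_set[of d "Suc i"]
  by (intro rev_image_eqI[of "d ! Suc i"]) (simp_all add: shift_down)

lemma shift_image_up:
  assumes "p \<in> \<P> - \<S>" "p \<noteq> d" "odd i" "i < len p"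
  shows "p ! Suc i \<in> shift \<S> d ` alternating_set \<P> {s} \<P>"
  using assms odd_nth_in_alternating_set[of p i]
  by (intro rev_image_eqI[of "p ! i"]) (simp_all add: shift_up)

lemma shift_image_s:
  assumes e: "e \<in> \<P> - \<S>" "even (len e)"
  shows "s \<in> shift \<S> d ` alternating_set \<P> {s} \<P>"
proof (cases "even (len d)")
  case True
  then show ?thesis
    by (intro rev_image_eqI[of s]) (simp_all add: shift_def alternating_set_def)
next
  case False
  then have "e ! Suc (len e - 1) \<in> shift \<S> d ` alternating_set \<P> {s} \<P>"
    using e len_pos[of e] by (intro shift_image_up) auto
  then show ?thesis
    using e len_pos[of e] path_nth_len[of e] by simp
qed

lemma alternating_set_subset_shift_image:
  assumes d: "d \<in> \<P> - \<S>" and e: "e \<in> \<P> - \<S>" "even (len e)"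
  shows "alternating_set \<P> {s, t} \<S> \<subseteq> shift \<S> d ` alternating_set \<P> {s} \<P>"
proof
  fix v assume "v \<in> alternating_set \<P> {s, t} \<S>"
  then consider (s) "v = s" | (t) "v = t"
    | (inner) p i where "p \<in> \<P>" "0 < i" "i < len p" "odd i \<longleftrightarrow> p \<in> \<S>" "v = p ! i"
    by (auto simp: alternating_set_def inner_parity_def)
  then show "v \<in> shift \<S> d ` alternating_set \<P> {s} \<P>"
  proof cases
    case s
    then show ?thesis
      using shift_image_s[OF e] by simp
  next
    case t
    then show ?thesis
      using shift_image_down[of d 0] d len_pos[of d] path_nth_0[of d] by simp
  next
    case inner
    consider (down) "p = d" | (stay) "p \<in> \<S>" | (up) "p \<in> \<P> - \<S>" "p \<noteq> d"
      using inner(1) by blast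
    then show ?thesis
    proof cases
      case down
      then show ?thesis
        using shift_image_down[of d i] inner d by simp
    next
      case stay
      then have "shift \<S> d (p ! i) = p ! i" "p ! i \<in> alternating_set \<P> {s} \<P>"
        using inner d odd_nth_in_alternating_set[of p i] by (auto simp: shift_inner_nth)
      then show ?thesis
        using inner(5) by (metis image_eqI)
    next
      case up
      then show ?thesis
        using shift_image_up[of p \<S> d "i - 1"] inner by simp
    qed
  qed
qed

end

section \<open>Melon graphs with one even path\<close>

locale single_even_melon = melon +
  fixes P\<^sub>e :: "'a list"
  assumes even_paths: "even_paths \<P> = {P\<^sub>e}" and k_ge_3: "k \<ge> 3"
begin

abbreviation Odd :: "'a list set" where "Odd \<equiv> odd_paths \<P>"

lemma even_path: "P\<^sub>e \<in> \<P>" "even (len P\<^sub>e)" "P\<^sub>e \<notin> Odd"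
  using even_paths by (auto simp: even_paths_def odd_paths_def)

lemma paths_eq: "\<P> = insert P\<^sub>e Odd"
  using even_paths by (auto simp: even_paths_def odd_paths_def)

lemma odd_path:
  assumes "p \<in> Odd"
  shows "p \<in> \<P>" "odd (len p)" "p \<noteq> P\<^sub>e"
  using assms even_path by (auto simp: odd_paths_def)

lemma finite_Odd: "finite Odd"
  using finite_paths by (simp add: odd_paths_def)

lemma card_Odd: "2 \<le> card Odd"
proof -
  have "card \<P> = Suc (card Odd)"
    using finite_Odd even_path(3) by (subst paths_eq) simp
  then show ?thesis
    using melon k_ge_3 by (simp add: melon_graph_def)
qed

lemma exists_other_odd_path: "\<exists>q \<in> Odd. q \<noteq> p"
proof -
  have "\<not> Odd \<subseteq> {p}"
    using card_Odd card_mono[of "{p}" Odd] by auto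
  then show ?thesis
    by blast
qed

lemma single_even_melon_rev: "single_even_melon k G t s (rev ` \<P>) (rev P\<^sub>e)"
  using melon_graph_rev[OF melon] even_paths k_ge_3
  by unfold_locales (simp_all add: even_paths_rev)

definition cover_number :: nat where
  "cover_number = 1 + (\<Sum>p \<in> \<P>. half p)"

lemma half_odd_path: "p \<in> Odd \<Longrightarrow> half p = (len p - 1) div 2"
  by (auto simp: half_def odd_paths_def elim: oddE)

lemma sum_paths: "(\<Sum>p \<in> \<P>. f p) = f P\<^sub>e + (\<Sum>p \<in> Odd. f p)" for f :: "'a list \<Rightarrow> nat"
  using finite_Odd even_path(3) by (subst paths_eq) simp

lemma cover_number_le_card:
  assumes U: "vertex_cover G U"
  shows "cover_number \<le> card U"
proof (cases "s \<in> U")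
  case True
  have "\<P> - {P\<^sub>e} = Odd"
    using paths_eq even_path(3) by blast
  then have "1 + len P\<^sub>e div 2 + (\<Sum>p \<in> Odd. (len p - 1) div 2) \<le> card U"
    using card_vertex_cover_ge[OF U even_path(1)] True by simp
  moreover have "(\<Sum>p \<in> Odd. half p) = (\<Sum>p \<in> Odd. (len p - 1) div 2)"
    by (intro sum.cong) (auto simp: half_odd_path)
  ultimately show ?thesis
    by (simp add: cover_number_def sum_paths half_def)
next
  case False
  obtain q where q: "q \<in> \<P>" "odd (len q)"
    using exists_other_odd_path odd_path by blast
  then have "Suc (len q) div 2 = Suc (half q)"
    by (simp add: half_def)
  then show ?thesis
    using card_vertex_cover_ge[OF U q(1)] False
    by (simp add: cover_number_def sum.remove[OF finite_paths q(1)] half_def)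
qed

lemma card_alternating_set_eq_cover_number:
  assumes "X \<subseteq> {s, t}" "X \<noteq> {}" "P\<^sub>e \<in> M \<longleftrightarrow> X \<noteq> {s, t}"
  shows "card (alternating_set \<P> X M) = cover_number"
proof -
  let ?inner = "\<lambda>p. if p \<in> M then half p else (len p - 1) div 2"
  have "(\<Sum>p \<in> Odd. ?inner p) = (\<Sum>p \<in> Odd. half p)"
    by (intro sum.cong) (auto simp: half_odd_path)
  moreover have "0 < half P\<^sub>e" "(len P\<^sub>e - 1) div 2 = half P\<^sub>e - 1"
    using even_path len_pos[of P\<^sub>e] by (auto simp: half_def elim!: evenE)
  moreover have "X = {s} \<or> X = {t} \<or> X = {s, t}"
    using assms by blast
  then have "card X = (if X = {s, t} then 2 else 1)"
    using s_neq_t by auto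
  ultimately show ?thesis
    using assms by (simp add: card_alternating_set cover_number_def sum_paths)
qed

lemma transition_s_to_st:
  assumes S: "\<S> \<subset> Odd" and p: "p \<in> \<P> - \<S>" and i: "i < len p"
  shows "transition G (p ! i) (p ! Suc i) (alternating_set \<P> {s} \<P>) (alternating_set \<P> {s, t} \<S>)"
    (is "transition G _ _ ?U ?W")
proof -
  have transition_shift: "transition G v w ?U ?W"
    if d: "d \<in> \<P> - \<S>" and v: "v \<in> ?U" "shift \<S> d v = w" for d v w
  proof (rule transition_onto)
    show "finite ?U"
      by (rule finite_subset[OF alternating_set_subset_verts finite_verts]) simp
    show "card ?W = card ?U"
      using S even_path s_neq_t card_alternating_set_eq_cover_number[of "{s}" \<P>]
        card_alternating_set_eq_cover_number[of "{s, t}" \<S>] by auto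
    show "?W \<subseteq> shift \<S> d ` ?U"
      using S even_path by (intro alternating_set_subset_shift_image[OF d, of P\<^sub>e]) auto
    show "shift \<S> d u \<in> closed_nbhd G u" if "u \<in> ?U" for u
      using that d by (intro shift_in_nbhd) auto
  qed (use v in auto)
  show ?thesis
  proof (cases "even i")
    case True
    then have "p ! Suc i \<in> ?U" "shift \<S> p (p ! Suc i) = p ! i"
      using p i by (auto intro: odd_nth_in_alternating_set shift_down)
    then show ?thesis
      using transition_shift[OF p] transition_commute[of G "p ! i"] by simp
  next
    case False
    obtain q where "q \<in> Odd" "q \<notin> \<S>"
      using S by blast
    then have "q \<in> \<P> - \<S>" "P\<^sub>e \<in> \<P> - \<S>" "q \<noteq> P\<^sub>e"
      using S even_path odd_path by auto
    then obtain d where d: "d \<in> \<P> - \<S>" "p \<noteq> d"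
      by metis
    then have "p ! i \<in> ?U" "shift \<S> d (p ! i) = p ! Suc i"
      using False p i by (auto intro: odd_nth_in_alternating_set shift_up)
    then show ?thesis
      using transition_shift[OF d(1)] by simp
  qed
qed

lemma alternating_set_rev_all:
  "alternating_set (rev ` \<P>) X (rev ` \<P>) = alternating_set \<P> X {P\<^sub>e}"
proof -
  have "{p \<in> \<P>. p \<in> \<P> \<longleftrightarrow> even (len p)} = {P\<^sub>e}"
    using even_paths by (auto simp: even_paths_def)
  then show ?thesis
    by (simp add: alternating_set_rev)
qed

lemma transition_t_to_st:
  assumes S: "\<S> \<noteq> {}" "\<S> \<subseteq> Odd" and p: "p \<in> insert P\<^sub>e \<S>" and i: "i < len p"
  shows "transition G (p ! i) (p ! Suc i)
    (alternating_set \<P> {t} {P\<^sub>e}) (alternating_set \<P> {s, t} \<S>)"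
proof -
  interpret rev: single_even_melon k G t s "rev ` \<P>" "rev P\<^sub>e"
    by (rule single_even_melon_rev)
  have p': "p \<in> \<P>" "p \<notin> Odd - \<S>"
    using p S even_path odd_path by auto
  have "{q \<in> \<P>. q \<in> Odd - \<S> \<longleftrightarrow> even (len q)} = \<S>"
    using S by (auto simp: odd_paths_def)
  then have "alternating_set (rev ` \<P>) {t, s} (rev ` (Odd - \<S>)) = alternating_set \<P> {s, t} \<S>"
    by (simp add: alternating_set_rev insert_commute)
  moreover have "transition G (rev p ! (len p - Suc i)) (rev p ! Suc (len p - Suc i))
      (alternating_set (rev ` \<P>) {t} (rev ` \<P>))
      (alternating_set (rev ` \<P>) {t, s} (rev ` (Odd - \<S>)))"
  proof (rule rev.transition_s_to_st)
    show "rev ` (Odd - \<S>) \<subset> odd_paths (rev ` \<P>)"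
      using S by (auto simp: odd_paths_rev inj_image_mem_iff)
    show "rev p \<in> rev ` \<P> - rev ` (Odd - \<S>)"
      using p' by (auto simp: inj_image_mem_iff)
    show "len p - Suc i < len (rev p)"
      using i by (simp add: path_length_rev)
  qed
  moreover have "rev p ! (len p - Suc i) = p ! Suc i" "rev p ! Suc (len p - Suc i) = p ! i"
    using i length_path[OF p'(1)] by (simp_all add: rev_nth_path_length Suc_diff_Suc)
  ultimately show ?thesis
    using transition_commute[of G "p ! i"] by (simp add: alternating_set_rev_all)
qed

definition evc_family :: "'a set set" where
  "evc_family = {alternating_set \<P> {s} \<P>, alternating_set \<P> {t} {P\<^sub>e}} \<union>
     {alternating_set \<P> {s, t} \<S> | \<S>. \<S> \<noteq> {} \<and> \<S> \<subset> Odd}"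

lemma st_in_evc_family:
  "\<S> \<noteq> {} \<Longrightarrow> \<S> \<subset> Odd \<Longrightarrow> alternating_set \<P> {s, t} \<S> \<in> evc_family"
  by (auto simp: evc_family_def)

lemma vertex_cover_evc_family:
  assumes "U \<in> evc_family"
  shows "vertex_cover G U"
proof -
  interpret rev: single_even_melon k G t s "rev ` \<P>" "rev P\<^sub>e"
    by (rule single_even_melon_rev)
  have "vertex_cover G (alternating_set \<P> {t} {P\<^sub>e})"
    using rev.vertex_cover_alternating_set[of "{t}" "rev ` \<P>"]
    by (simp add: alternating_set_rev_all)
  then show ?thesis
    using assms vertex_cover_alternating_set[of "{s}" \<P>] vertex_cover_alternating_set[of "{s, t}"]
    unfolding evc_family_def by auto
qed

lemma card_evc_family:
  assumes "U \<in> evc_family"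
  shows "card U = cover_number"
proof -
  have "{s} \<noteq> {s, t}" "{t} \<noteq> {s, t}"
    using s_neq_t by auto
  then show ?thesis
    using assms even_path unfolding evc_family_def
    by (auto intro!: card_alternating_set_eq_cover_number)
qed

lemma vc_eq_cover_number: "vc G = cover_number"
proof -
  have U: "alternating_set \<P> {s} \<P> \<in> evc_family"
    by (simp add: evc_family_def)
  have "vc G = card (alternating_set \<P> {s} \<P>)"
    using vertex_cover_evc_family[OF U] cover_number_le_card card_evc_family[OF U]
    by (intro vc_eqI) auto
  then show ?thesis
    by (simp add: card_evc_family[OF U])
qed

lemma evc_family_answers_attack:
  assumes U: "U \<in> evc_family" and p: "p \<in> \<P>" and i: "i < len p"
  shows "\<exists>W \<in> evc_family. transition G (p ! i) (p ! Suc i) U W"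
proof -
  obtain q where q: "q \<in> Odd" "p \<in> Odd \<Longrightarrow> q = p"
    using exists_other_odd_path by blast
  obtain r where r: "r \<in> Odd" "r \<noteq> q"
    using exists_other_odd_path by blast
  consider (s) "U = alternating_set \<P> {s} \<P>" | (t) "U = alternating_set \<P> {t} {P\<^sub>e}"
    | (st) \<S> where "U = alternating_set \<P> {s, t} \<S>" "\<S> \<noteq> {}" "\<S> \<subset> Odd"
    using U by (auto simp: evc_family_def)
  then show ?thesis
  proof cases
    case s
    have S: "Odd - {q} \<noteq> {}" "Odd - {q} \<subset> Odd" "p \<in> \<P> - (Odd - {q})"
      using q r p by auto
    then show ?thesis
      using s st_in_evc_family[OF S(1,2)] transition_s_to_st[OF S(2,3) i] by blast
  next
    case t
    have S: "{q} \<subset> Odd" "p \<in> insert P\<^sub>e {q}"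
      using q r p paths_eq by auto
    then show ?thesis
      using t st_in_evc_family[OF _ S(1)] transition_t_to_st[OF _ _ S(2) i] by blast
  next
    case (st \<S>)
    show ?thesis
    proof (cases "p \<in> \<S>")
      case True
      then have "transition G (p ! i) (p ! Suc i) U (alternating_set \<P> {t} {P\<^sub>e})"
        using st transition_sym[OF transition_t_to_st[of \<S>, OF _ _ _ i]] by simp
      then show ?thesis
        by (auto simp: evc_family_def)
    next
      case False
      then have "transition G (p ! i) (p ! Suc i) U (alternating_set \<P> {s} \<P>)"
        using st p transition_sym[OF transition_s_to_st[of \<S>, OF _ _ i]] by simp
      then show ?thesis
        by (auto simp: evc_family_def)
    qed
  qed
qed

lemma evc_class_evc_family: "evc_class G (vc G) evc_family"
proof (rule evc_classI)
  show "evc_family \<noteq> {}"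
    by (simp add: evc_family_def)
  show "card U = vc G" if "U \<in> evc_family" for U
    using that by (simp add: card_evc_family vc_eq_cover_number)
  show "\<exists>W \<in> evc_family. transition G v w U W" if "U \<in> evc_family" "{v, w} \<in> edges G" for U v w
    using that(2)
  proof (cases rule: edgeE)
    case (up p i)
    then show ?thesis
      using evc_family_answers_attack[OF that(1)] by simp
  next
    case (down p i)
    then show ?thesis
      using evc_family_answers_attack[OF that(1)] transition_commute by metis
  qed
qed (rule vertex_cover_evc_family)

lemma UN_paths: "(\<Union>p \<in> \<P>. f p) = f P\<^sub>e \<union> (\<Union>p \<in> Odd. f p)"
  by (subst paths_eq) simp

lemma U_s_eq_alternating_set: "U_s s P\<^sub>e \<P> = alternating_set \<P> {s} \<P>"
proof -
  have "(\<Union>p \<in> Odd. {p ! (2 * i + 1) | i. i \<le> half p}) =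
      (\<Union>p \<in> Odd. insert s (inner_parity True p))"
    using odd_path by (intro SUP_cong) (auto simp: odd_positions_odd_path path_nth_len)
  then show ?thesis
    using UN_paths[of "inner_parity True"] even_path
    by (auto simp: U_s_def alternating_set_def odd_positions_even_path)
qed

lemma U_t_eq_alternating_set: "U_t t P\<^sub>e \<P> = alternating_set \<P> {t} {P\<^sub>e}"
proof -
  have "(\<Union>p \<in> Odd. {p ! (2 * i) | i. i \<le> half p}) =
      (\<Union>p \<in> Odd. insert t (inner_parity (p \<in> {P\<^sub>e}) p))"
    using odd_path even_path by (intro SUP_cong) (auto simp: even_positions_odd_path path_nth_0)
  then show ?thesis
    using UN_paths[of "\<lambda>p. inner_parity (p \<in> {P\<^sub>e}) p"] even_path
    by (auto simp: U_t_def alternating_set_def odd_positions_even_path)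
qed

lemma U_odd_eq_alternating_set:
  assumes S: "\<S> \<subseteq> Odd"
  shows "U_odd G s t P\<^sub>e \<P> \<S> = alternating_set \<P> {s, t} \<S>" (is "_ = ?U")
  unfolding U_odd_def
proof (rule the1_equality[OF U_odd_unique_existence[OF melon even_paths S]])
  have "P\<^sub>e \<notin> \<S>"
    using S even_path by blast
  then have "internal_path ?U P\<^sub>e"
    using even_path
    by (auto simp: internal_path_def even_positions_even_path alternating_set_Int_path
        path_nth_0 path_nth_len)
  moreover have "s_path t ?U p" if "p \<in> \<S>" for p
  proof -
    have p: "p \<in> \<P>" "odd (len p)"
      using that S odd_path by auto
    then show ?thesis
      using that s_neq_t ends_notin_inner_parity[OF p(1)] unfolding s_path_def
      by (auto simp: odd_positions_odd_path alternating_set_Int_path path_nth_len)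
  qed
  moreover have "t_path s ?U p" if "p \<in> Odd - \<S>" for p
  proof -
    have p: "p \<in> \<P>" "odd (len p)"
      using that odd_path by auto
    then show ?thesis
      using that s_neq_t ends_notin_inner_parity[OF p(1)] unfolding t_path_def
      by (auto simp: even_positions_odd_path alternating_set_Int_path path_nth_0)
  qed
  ultimately show "is_U_odd G s t P\<^sub>e \<P> \<S> ?U"
    using alternating_set_subset_verts by (simp add: is_U_odd_def)
qed

lemma evc_family_eq:
  "{U_s s P\<^sub>e \<P>, U_t t P\<^sub>e \<P>} \<union> {U_odd G s t P\<^sub>e \<P> \<S> | \<S>. \<S> \<noteq> {} \<and> \<S> \<subset> Odd} = evc_family"
proof -
  have "{U_odd G s t P\<^sub>e \<P> \<S> | \<S>. \<S> \<noteq> {} \<and> \<S> \<subset> Odd} =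
      {alternating_set \<P> {s, t} \<S> | \<S>. \<S> \<noteq> {} \<and> \<S> \<subset> Odd}"
    using U_odd_eq_alternating_set by (metis (no_types, opaque_lifting) psubset_imp_subset)
  then show ?thesis
    by (simp add: evc_family_def U_s_eq_alternating_set U_t_eq_alternating_set)
qed

end

theorem theorem15:
  fixes k :: nat and G :: "'a ugraph" and s t :: 'a
    and \<P> :: "'a list set" and P\<^sub>e :: "'a list"
  assumes "k \<ge> 3"
    and "melon_graph k G s t \<P>"
    and "mixed \<P>"
    and "even_paths \<P> = {P\<^sub>e}"
  shows "evc G = vc G \<and>
    minimum_evc_class G
      ({U_s s P\<^sub>e \<P>, U_t t P\<^sub>e \<P>} \<union>
       {U_odd G s t P\<^sub>e \<P> \<S> | \<S>. \<S> \<noteq> {} \<and> \<S> \<subset> odd_paths \<P>})"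
proof -
  interpret single_even_melon k G s t \<P> P\<^sub>e
    using assms by unfold_locales
  have "evc G = vc G"
    by (rule evc_eq_vc_if_evc_class[OF evc_class_evc_family])
  then show ?thesis
    unfolding minimum_evc_class_def evc_family_eq using evc_class_evc_family by simp
qed

end
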